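(* Let $G$ be a graph on an infinite vertex set $E$ such that for every $n\in\mathbb{N}$ the set $E_n(G)=\{x\in E:\deg(x)=n\}$ is finite. Then $G$ is Ulam-reconstructible.
   Context: A graph on $E$ is a simple undirected graph with vertex set $E$; $G|F$ is the induced subgraph on $F\subseteq E$; $\deg(x)$ is the number (cardinality of the set) of $y\in E\setminus\{x\}$ adjacent to $x$ in $G$. Two graphs $G,G'$ on $E$ are $(-1)$-hypomorphic if $G|(E\setminus\{x\})$ and $G'|(E\setminus\{x\})$ are isomorphic for every $x\in E$. $G$ is Ulam-reconstructible if every graph $G'$ on $E$ that is $(-1)$-hypomorphic to $G$ is isomorphic to $G$.
   Formalization: The formal theorem also assumes that each infinite cardinal is the degree of only finitely many vertices; without this the claim fails (the tree with all degrees ℵ₀ versus two disjoint copies of it). The condition is vacuous for locally finite graphs. *)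

theory Defs
  imports Main "HOL-Library.Equipollence"
begin

(* A graph on E is given by its adjacency relation; the relation holds only
   between elements of E, so it is determined by the graph. *)
definition graph_on :: "'a set \<Rightarrow> ('a \<Rightarrow> 'a \<Rightarrow> bool) \<Rightarrow> bool" where
  "graph_on E G \<longleftrightarrow>
     (\<forall>x y. G x y \<longrightarrow> x \<in> E \<and> y \<in> E) \<and>
     (\<forall>x y. G x y \<longrightarrow> G y x) \<and>
     (\<forall>x. \<not> G x x)"

definition induced_subgraph :: "('a \<Rightarrow> 'a \<Rightarrow> bool) \<Rightarrow> 'a set \<Rightarrow> 'a \<Rightarrow> 'a \<Rightarrow> bool" where
  "induced_subgraph G F x y \<longleftrightarrow> x \<in> F \<and> y \<in> F \<and> G x y"

definition graph_isomorphic ::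
    "'a set \<Rightarrow> ('a \<Rightarrow> 'a \<Rightarrow> bool) \<Rightarrow> 'b set \<Rightarrow> ('b \<Rightarrow> 'b \<Rightarrow> bool) \<Rightarrow> bool" where
  "graph_isomorphic E G E' G' \<longleftrightarrow>
     (\<exists>f. bij_betw f E E' \<and> (\<forall>x\<in>E. \<forall>y\<in>E. G x y \<longleftrightarrow> G' (f x) (f y)))"

definition hypomorphic ::
    "'a set \<Rightarrow> ('a \<Rightarrow> 'a \<Rightarrow> bool) \<Rightarrow> ('a \<Rightarrow> 'a \<Rightarrow> bool) \<Rightarrow> bool" where
  "hypomorphic E G G' \<longleftrightarrow>
     (\<forall>x\<in>E. graph_isomorphic (E - {x}) (induced_subgraph G (E - {x}))
                              (E - {x}) (induced_subgraph G' (E - {x})))"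

definition ulam_reconstructible :: "'a set \<Rightarrow> ('a \<Rightarrow> 'a \<Rightarrow> bool) \<Rightarrow> bool" where
  "ulam_reconstructible E G \<longleftrightarrow>
     (\<forall>G'. graph_on E G' \<longrightarrow> hypomorphic E G G' \<longrightarrow> graph_isomorphic E G E G')"

definition nbrs :: "'a set \<Rightarrow> ('a \<Rightarrow> 'a \<Rightarrow> bool) \<Rightarrow> 'a \<Rightarrow> 'a set" where
  "nbrs E G x = {y \<in> E - {x}. G x y}"

(* The degree of x is the cardinality of nbrs E G x, possibly infinite. The
   finiteness condition is needed because card is 0 on infinite sets. *)
definition degree_class :: "'a set \<Rightarrow> ('a \<Rightarrow> 'a \<Rightarrow> bool) \<Rightarrow> nat \<Rightarrow> 'a set" where
  "degree_class E G n = {x \<in> E. finite (nbrs E G x) \<and> card (nbrs E G x) = n}"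

(* Finiteness of degree_class E G n for all natural n says nothing about
   vertices of infinite degree, and does not imply reconstructibility: the tree
   T in which every vertex has degree aleph_0 and the disjoint union of two
   copies of T are hypomorphic (deleting any vertex leaves countably many copies
   of T) but not isomorphic. Hence the theorem also asks that each infinite
   cardinal be the degree of only finitely many vertices; this is vacuous for
   locally finite graphs. *)

end

theory Submission
  imports Defs
begin

text \<open>
  An isomorphism \<open>\<phi> x\<close> from \<open>G - x\<close> to \<open>G' - x\<close> changes finite degrees by at most one and
  preserves infinite degrees. As only finitely many vertices share a degree, first of \<open>G\<close> and
  hence of \<open>G'\<close>, for fixed \<open>y\<close> and \<open>z\<close> the values \<open>\<phi> x y\<close> and the preimages of \<open>z\<close> under \<open>\<phi> x\<close>
  range over finite sets as \<open>x\<close> varies. The pointwise limit of \<open>\<phi> x\<close> along a nonprincipal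
  ultrafilter in \<open>x\<close> therefore exists and is a bijection, and it is an isomorphism because any
  two vertices are avoided by almost all \<open>x\<close>.
\<close>

definition ultrafilter :: "'a filter \<Rightarrow> bool" where
  "ultrafilter U \<longleftrightarrow>
     U \<noteq> bot \<and> (\<forall>P. (\<forall>\<^sub>F x in U. P x) \<or> (\<forall>\<^sub>F x in U. \<not> P x))"

text \<open>In the order on filters the finer one is smaller, so an ultrafilter is a minimal proper
  filter. Zorn's lemma is therefore applied to the reversed order on the proper filters below
  \<open>F\<close>.\<close>

lemma ultrafilter_exists:
  assumes "F \<noteq> bot"
  obtains U where "ultrafilter U" "U \<le> F"
proof -
  let ?A = "{H. H \<noteq> bot \<and> H \<le> F}"
  have "\<exists>U\<in>?A. \<forall>H\<in>?A. H \<le> U \<longrightarrow> H = U"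
  proof (rule predicate_Zorn)
    show "partial_order_on ?A (relation_of (\<lambda>H K. K \<le> H) ?A)"
      by (auto simp: partial_order_on_def preorder_on_def refl_on_def relation_of_def
          trans_def antisym_def)
  next
    fix C assume C: "C \<in> Chains (relation_of (\<lambda>H K. K \<le> H) ?A)"
    then have sub: "C \<subseteq> ?A" and chain: "\<And>H K. H \<in> C \<Longrightarrow> K \<in> C \<Longrightarrow> H \<le> K \<or> K \<le> H"
      by (auto simp: Chains_def relation_of_def)
    show "\<exists>u\<in>?A. \<forall>H\<in>C. u \<le> H"
    proof (cases "C = {}")
      case True
      then show ?thesis using assms by auto
    next
      case False
      \<comment> \<open>A chain is directed downwards, so whatever holds eventually in
        \<open>Inf C\<close> already does so in a member of \<open>C\<close>. For the predicate
        \<open>False\<close> this shows that the infimum is proper.\<close>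
      have "\<exists>x\<in>C. x \<le> inf H K" if "H \<in> C" "K \<in> C" for H K
        using chain[OF that] that by (auto simp: inf_absorb1 inf_absorb2)
      then have "eventually P (Inf C) \<longleftrightarrow> (\<exists>H\<in>C. eventually P H)" for P
        using eventually_Inf_base[OF False] by blast
      then have "Inf C \<noteq> bot"
        using sub by (auto simp: trivial_limit_def)
      moreover have "Inf C \<le> F"
        using False sub by (auto intro: Inf_lower2)
      ultimately show ?thesis
        by (auto intro: Inf_lower)
    qed
  qed
  then obtain U where U: "U \<noteq> bot" "U \<le> F"
    and min: "\<And>H. H \<noteq> bot \<Longrightarrow> H \<le> U \<Longrightarrow> H = U"
    by (auto intro: order_trans)
  have "(\<forall>\<^sub>F x in U. P x) \<or> (\<forall>\<^sub>F x in U. \<not> P x)" for P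
  proof (rule disjCI)
    \<comment> \<open>Adding the set where \<open>P\<close> holds to \<open>U\<close> keeps it
      proper, so by minimality \<open>U\<close> contained that set already.\<close>
    assume "\<not> (\<forall>\<^sub>F x in U. \<not> P x)"
    then have "inf U (principal {x. P x}) \<noteq> bot"
      by (simp add: trivial_limit_def eventually_inf_principal)
    then have "inf U (principal {x. P x}) = U"
      by (rule min) simp
    then have "U \<le> principal {x. P x}"
      by (metis inf.cobounded2)
    then show "\<forall>\<^sub>F x in U. P x"
      by (simp add: le_principal)
  qed
  then show thesis
    using U that by (auto simp: ultrafilter_def)
qed

text \<open>This provides the pointwise limits. If each of the finitely many values were avoided
  almost everywhere, all of them would be avoided simultaneously.\<close>

lemma ultrafilter_finite_range:
  assumes U: "ultrafilter U" and "finite K" and "\<forall>\<^sub>F x in U. f x \<in> K"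
  shows "\<exists>k\<in>K. \<forall>\<^sub>F x in U. f x = k"
proof (rule ccontr)
  assume "\<not> ?thesis"
  then have "\<forall>k\<in>K. \<forall>\<^sub>F x in U. f x \<noteq> k"
    using U by (auto simp: ultrafilter_def)
  then have "\<forall>\<^sub>F x in U. \<forall>k\<in>K. f x \<noteq> k"
    using \<open>finite K\<close> by (simp add: eventually_ball_finite_distrib)
  with assms(3) have "\<forall>\<^sub>F x in U. False"
    by eventually_elim auto
  then show False
    using U by (simp add: ultrafilter_def trivial_limit_def)
qed

text \<open>Comparison of degrees up to an error \<open>k\<close>. The error matters for finite sets
  only, since an infinite cardinal absorbs finite changes; errors add up under composition.\<close>

definition almost_eqpoll :: "nat \<Rightarrow> 'a set \<Rightarrow> 'b set \<Rightarrow> bool" where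
  "almost_eqpoll k A B \<longleftrightarrow>
     (if finite A then finite B \<and> card A \<le> card B + k \<and> card B \<le> card A + k else A \<approx> B)"

lemma almost_eqpoll_sym: "almost_eqpoll k A B \<Longrightarrow> almost_eqpoll k B A"
  by (auto simp: almost_eqpoll_def eqpoll_finite_iff intro: eqpoll_sym split: if_splits)

lemma almost_eqpoll_trans:
  assumes "almost_eqpoll k A B" "almost_eqpoll l B C"
  shows "almost_eqpoll (k + l) A C"
  using assms eqpoll_finite_iff[of A B]
  by (auto simp: almost_eqpoll_def intro: eqpoll_trans split: if_splits)

lemma infinite_Diff_singleton_eqpoll:
  assumes "infinite A"
  shows "A - {a} \<approx> A"
proof (cases "a \<in> A")
  case True
  have "insert a (A - {a}) \<approx> A - {a}"
    using assms by (intro infinite_insert_eqpoll) simp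
  then show ?thesis
    using True by (simp add: insert_absorb eqpoll_sym)
qed simp

lemma almost_eqpoll_if_Diff_singleton_eqpoll:
  assumes eq: "A - {a} \<approx> B - {b}"
  shows "almost_eqpoll 1 A B"
proof (cases "finite A")
  case True
  then have "finite (B - {b})"
    using eq eqpoll_finite_iff by blast
  then have fB: "finite B" by simp
  have "card (A - {a}) = card (B - {b})"
    using True fB eq eqpoll_iff_card[of "A - {a}" "B - {b}"] by simp
  then show ?thesis
    using True fB by (auto simp: almost_eqpoll_def card_Diff_singleton_if split: if_splits)
next
  case False
  then have "infinite B"
    using eqpoll_finite_iff[OF eq] by simp
  with False eq show ?thesis
    by (metis almost_eqpoll_def eqpoll_sym eqpoll_trans infinite_Diff_singleton_eqpoll)
qed

text \<open>A finite \<open>B\<close> leaves only the degrees up to \<open>card B + k\<close>, while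
  an infinite \<open>B\<close> leaves one exact cardinal. The set \<open>B\<close> is arbitrary
  because it will also be a neighbourhood in the other graph, whose cardinality need not be known to
  occur as a degree in \<open>G\<close>.\<close>

lemma finite_almost_eqpoll_nbrs:
  assumes fin: "\<And>n. finite (degree_class E G n)"
    and inf: "\<And>x. x \<in> E \<Longrightarrow> infinite (nbrs E G x) \<Longrightarrow> finite {y \<in> E. nbrs E G y \<approx> nbrs E G x}"
  shows "finite {y \<in> E. almost_eqpoll k (nbrs E G y) B}"
proof (cases "finite B")
  case True
  have "{y \<in> E. almost_eqpoll k (nbrs E G y) B} \<subseteq> (\<Union>n\<le>card B + k. degree_class E G n)"
    using True eqpoll_finite_iff
    by (auto simp: almost_eqpoll_def degree_class_def split: if_splits)
  then show ?thesis
    by (rule finite_subset) (auto intro: fin)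
next
  case False
  have eq: "almost_eqpoll k A B \<longleftrightarrow> A \<approx> B" for A :: "'a set"
    using False eqpoll_finite_iff[of A B] by (auto simp: almost_eqpoll_def)
  show ?thesis
  proof (cases "\<exists>x\<in>E. nbrs E G x \<approx> B")
    case True
    then obtain x where x: "x \<in> E" "nbrs E G x \<approx> B" by blast
    then have "infinite (nbrs E G x)"
      using False eqpoll_finite_iff by blast
    then have "finite {y \<in> E. nbrs E G y \<approx> nbrs E G x}"
      using inf x by blast
    then show ?thesis
      by (rule rev_finite_subset) (use x eq eqpoll_sym eqpoll_trans in blast)
  next
    case False
    then have "{y \<in> E. almost_eqpoll k (nbrs E G y) B} = {}"
      using eq by blast
    then show ?thesis by (simp only: finite.emptyI)
  qed
qed

definition deleted_iso ::
    "'a set \<Rightarrow> ('a \<Rightarrow> 'a \<Rightarrow> bool) \<Rightarrow> ('a \<Rightarrow> 'a \<Rightarrow> bool) \<Rightarrow> 'a \<Rightarrow> ('a \<Rightarrow> 'a) \<Rightarrow> bool" where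
  "deleted_iso E G G' x f \<longleftrightarrow>
     bij_betw f (E - {x}) (E - {x}) \<and>
     (\<forall>y\<in>E - {x}. \<forall>z\<in>E - {x}. G y z \<longleftrightarrow> G' (f y) (f z))"

text \<open>As \<open>f\<close> maps \<open>E - {x}\<close> to itself, the membership conditions in
  \<open>induced_subgraph\<close> hold automatically.\<close>

lemma hypomorphic_iff_deleted_iso:
  "hypomorphic E G G' \<longleftrightarrow> (\<forall>x\<in>E. \<exists>f. deleted_iso E G G' x f)"
proof -
  have "induced_subgraph G' (E - {x}) (f y) (f z) \<longleftrightarrow> G' (f y) (f z)"
    if "bij_betw f (E - {x}) (E - {x})" "y \<in> E - {x}" "z \<in> E - {x}" for f x y z
    using that bij_betwE[OF that(1)] by (auto simp: induced_subgraph_def)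
  then show ?thesis
    unfolding hypomorphic_def graph_isomorphic_def deleted_iso_def
    by (simp add: induced_subgraph_def cong: conj_cong)
qed

text \<open>The map \<open>f\<close> matches the neighbours other than \<open>x\<close> on both
  sides. Only \<open>x\<close> itself may be adjacent to one of \<open>y\<close> and
  \<open>f y\<close> and not to the other, whence the error 1.\<close>

lemma deleted_iso_almost_eqpoll_nbrs:
  assumes iso: "deleted_iso E G G' x f" and y: "y \<in> E - {x}"
  shows "almost_eqpoll 1 (nbrs E G y) (nbrs E G' (f y))"
proof (rule almost_eqpoll_if_Diff_singleton_eqpoll)
  have bij: "bij_betw f (E - {x}) (E - {x})"
    and adj: "\<And>z. z \<in> E - {x} \<Longrightarrow> G y z \<longleftrightarrow> G' (f y) (f z)"
    using iso y by (auto simp: deleted_iso_def)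
  have "f ` (nbrs E G y - {x}) = nbrs E G' (f y) - {x}"
  proof (intro set_eqI iffI)
    fix w assume "w \<in> f ` (nbrs E G y - {x})"
    then obtain z where z: "z \<in> E - {x}" "z \<noteq> y" "G y z" "w = f z"
      by (auto simp: nbrs_def)
    then have "f z \<noteq> f y" "f z \<in> E - {x}" "G' (f y) (f z)"
      using bij y adj by (auto simp: bij_betw_def inj_on_def)
    then show "w \<in> nbrs E G' (f y) - {x}"
      using z by (auto simp: nbrs_def)
  next
    fix w assume w: "w \<in> nbrs E G' (f y) - {x}"
    then have "w \<in> f ` (E - {x})"
      using bij by (auto simp: bij_betw_def nbrs_def)
    then obtain z where z: "z \<in> E - {x}" "w = f z" by blast
    with w adj show "w \<in> f ` (nbrs E G y - {x})"
      by (auto simp: nbrs_def)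
  qed
  moreover have "inj_on f (nbrs E G y - {x})"
    using bij by (auto simp: bij_betw_def nbrs_def intro: inj_on_subset)
  ultimately show "nbrs E G y - {x} \<approx> nbrs E G' (f y) - {x}"
    by (auto simp: eqpoll_def bij_betw_def)
qed

text \<open>Finiteness passes from \<open>G\<close> to \<open>G'\<close>: every vertex except
  \<open>x\<close> is some \<open>f y\<close>, and going back to \<open>y\<close> costs one more
  unit of error. The vertex \<open>x\<close> has to be added by hand, being outside the image of
  \<open>E - {x}\<close>.\<close>

lemma deleted_iso_finite_almost_eqpoll_nbrs:
  assumes iso: "deleted_iso E G G' x f"
    and fin: "\<And>k B. finite {y \<in> E. almost_eqpoll k (nbrs E G y) (B :: 'a set)}"
  shows "finite {z \<in> E. almost_eqpoll k (nbrs E G' z) (B :: 'a set)}"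
proof (rule finite_subset)
  show "{z \<in> E. almost_eqpoll k (nbrs E G' z) B} \<subseteq>
      insert x (f ` {y \<in> E. almost_eqpoll (1 + k) (nbrs E G y) B})"
  proof
    fix z assume z: "z \<in> {z \<in> E. almost_eqpoll k (nbrs E G' z) B}"
    show "z \<in> insert x (f ` {y \<in> E. almost_eqpoll (1 + k) (nbrs E G y) B})"
    proof (cases "z = x")
      case False
      then have "z \<in> f ` (E - {x})"
        using iso z by (auto simp: deleted_iso_def bij_betw_def)
      then obtain y where "y \<in> E - {x}" "z = f y" by blast
      then show ?thesis
        using z almost_eqpoll_trans[OF deleted_iso_almost_eqpoll_nbrs[OF iso]] by blast
    qed simp
  qed
qed (simp add: fin)

text \<open>The cofinite filter restricted to \<open>E\<close> is proper because \<open>E\<close> is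
  infinite; any ultrafilter below it will do.\<close>

lemma cofinite_ultrafilter_exists:
  assumes "infinite E"
  obtains U where "ultrafilter U" "\<And>F. finite F \<Longrightarrow> \<forall>\<^sub>F x in U. x \<in> E - F"
proof -
  have ev: "eventually P (inf cofinite (principal E)) \<longleftrightarrow> finite {x \<in> E. \<not> P x}" for P
    by (simp add: eventually_inf_principal eventually_cofinite)
  then have "inf cofinite (principal E) \<noteq> bot"
    using assms by (simp add: trivial_limit_def)
  then obtain U where U: "ultrafilter U" "U \<le> inf cofinite (principal E)"
    by (rule ultrafilter_exists)
  have "\<forall>\<^sub>F x in U. x \<in> E - F" if "finite F" for F
    using U(2) by (rule filter_leD) (use that in \<open>auto simp: ev intro: finite_subset[of _ F]\<close>)
  then show thesis
    using U(1) that by blast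
qed

theorem mainTheorem13:
  fixes E :: "'a set" and G :: "'a \<Rightarrow> 'a \<Rightarrow> bool"
  assumes "infinite E"
    and "graph_on E G"
    and "\<And>n::nat. finite (degree_class E G n)"
    and "\<And>x. x \<in> E \<Longrightarrow> infinite (nbrs E G x) \<Longrightarrow> finite {y \<in> E. nbrs E G y \<approx> nbrs E G x}"
  shows "ulam_reconstructible E G"
  unfolding ulam_reconstructible_def
proof (intro allI impI)
  fix G' assume "hypomorphic E G G'"
  then obtain \<phi> where \<phi>: "\<And>x. x \<in> E \<Longrightarrow> deleted_iso E G G' x (\<phi> x)"
    unfolding hypomorphic_iff_deleted_iso by metis
  have finG: "finite {y \<in> E. almost_eqpoll k (nbrs E G y) (B :: 'a set)}" for k B
    using assms(3,4) by (rule finite_almost_eqpoll_nbrs)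
  obtain x0 where "x0 \<in> E"
    using \<open>infinite E\<close> using infinite_imp_nonempty by blast
  have finG': "finite {z \<in> E. almost_eqpoll k (nbrs E G' z) (B :: 'a set)}" for k B
    using \<phi>[OF \<open>x0 \<in> E\<close>] finG by (rule deleted_iso_finite_almost_eqpoll_nbrs)
  obtain U where U: "ultrafilter U"
    and avoid: "\<And>F. finite F \<Longrightarrow> \<forall>\<^sub>F x in U. x \<in> E - F"
    using cofinite_ultrafilter_exists[OF \<open>infinite E\<close>] by blast
  have ex: "\<exists>x. P x" if "\<forall>\<^sub>F x in U. P x" for P
    using eventually_happens[OF that] U by (auto simp: ultrafilter_def)
  \<comment> \<open>The set on the right does not depend on \<open>x\<close> and is finite by
    \<open>finG'\<close>, so the limit \<open>h y\<close> of \<open>\<phi> x y\<close>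
    exists.\<close>
  have range: "\<phi> x y \<in> {z \<in> E. almost_eqpoll 1 (nbrs E G' z) (nbrs E G y)}"
    if "x \<in> E" "y \<in> E - {x}" for x y
    using deleted_iso_almost_eqpoll_nbrs[OF \<phi>[OF that(1)] that(2)] \<phi>[OF that(1)] that(2)
    by (auto simp: deleted_iso_def bij_betw_def intro: almost_eqpoll_sym)
  have "\<exists>z\<in>E. \<forall>\<^sub>F x in U. \<phi> x y = z" if "y \<in> E" for y
  proof -
    have "\<forall>\<^sub>F x in U. \<phi> x y \<in> {z \<in> E. almost_eqpoll 1 (nbrs E G' z) (nbrs E G y)}"
      by (rule eventually_mono[OF avoid[of "{y}"]]) (use range that in blast)+
    from ultrafilter_finite_range[OF U finG' this] show ?thesis by blast
  qed
  then obtain h where hE: "\<And>y. y \<in> E \<Longrightarrow> h y \<in> E"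
    and h: "\<And>y. y \<in> E \<Longrightarrow> \<forall>\<^sub>F x in U. \<phi> x y = h y"
    by metis
  \<comment> \<open>A claim about \<open>h\<close> at two vertices can be checked on a single
    \<open>\<phi> x\<close> that agrees with \<open>h\<close> at both. Injectivity and preservation
    of adjacency are such claims.\<close>
  have two: "\<exists>x\<in>E. y \<in> E - {x} \<and> z \<in> E - {x} \<and> \<phi> x y = h y \<and> \<phi> x z = h z"
    if "y \<in> E" "z \<in> E" for y z
  proof -
    have "\<forall>\<^sub>F x in U. x \<in> E - {y, z} \<and> \<phi> x y = h y \<and> \<phi> x z = h z"
      using avoid[of "{y, z}"] h that by (simp add: eventually_conj_iff)
    from ex[OF this] show ?thesis using that by auto
  qed
  have "inj_on h E"
  proof (rule inj_onI)
    fix y z assume yz: "y \<in> E" "z \<in> E" "h y = h z"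
    from two[OF yz(1,2)] obtain x where
      x: "x \<in> E" "y \<in> E - {x}" "z \<in> E - {x}" "\<phi> x y = \<phi> x z"
      using yz(3) by metis
    then show "y = z"
      using \<phi>[OF x(1)] by (auto simp: deleted_iso_def bij_betw_def dest: inj_onD)
  qed
  moreover have "z \<in> h ` E" if z: "z \<in> E" for z
  proof -
    \<comment> \<open>Surjectivity is a limit argument for preimages: the preimage
      \<open>\<psi> x\<close> of \<open>z\<close> under \<open>\<phi> x\<close> stays in a finite
      set given by \<open>finG\<close>, hence is almost always one vertex \<open>y\<close>. Any
      \<open>x\<close> with \<open>\<psi> x = y\<close> and \<open>\<phi> x y = h y\<close> then
      gives \<open>h y = z\<close>.\<close>
    have pre: "\<exists>y. y \<in> E - {x} \<and> \<phi> x y = z" if "x \<in> E - {z}" for x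
    proof -
      have "z \<in> \<phi> x ` (E - {x})"
        using \<phi>[of x] that z by (auto simp: deleted_iso_def bij_betw_def)
      then show ?thesis by blast
    qed
    then obtain \<psi> where \<psi>: "\<And>x. x \<in> E - {z} \<Longrightarrow> \<psi> x \<in> E - {x} \<and> \<phi> x (\<psi> x) = z"
      by metis
    have "\<psi> x \<in> {y \<in> E. almost_eqpoll 1 (nbrs E G y) (nbrs E G' z)}" if "x \<in> E - {z}" for x
      using range[of x "\<psi> x"] \<psi>[OF that] that by (auto intro: almost_eqpoll_sym)
    then have "\<forall>\<^sub>F x in U. \<psi> x \<in> {y \<in> E. almost_eqpoll 1 (nbrs E G y) (nbrs E G' z)}"
      using avoid[of "{z}"] by (auto elim: eventually_mono)
    from ultrafilter_finite_range[OF U finG this]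
    obtain y where y: "y \<in> E" "\<forall>\<^sub>F x in U. \<psi> x = y" by blast
    have "\<forall>\<^sub>F x in U. x \<in> E - {z} \<and> \<psi> x = y \<and> \<phi> x y = h y"
      using avoid[of "{z}"] y h by (simp add: eventually_conj_iff)
    from ex[OF this] have "h y = z" using \<psi> by metis
    then show ?thesis using y(1) by blast
  qed
  ultimately have "bij_betw h E E"
    using hE by (auto simp: bij_betw_def)
  moreover have "G y z \<longleftrightarrow> G' (h y) (h z)" if "y \<in> E" "z \<in> E" for y z
    using two[OF that] \<phi> unfolding deleted_iso_def by metis
  ultimately show "graph_isomorphic E G E G'"
    by (auto simp: graph_isomorphic_def)
qed

end
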